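(* Let $A\in\mathbb{R}^{n\times n}$, $B\in\mathbb{R}^{n\times r}$, $H\in\mathbb{R}^{p\times n}$, and consider the linear control system $\dot x(t)=Ax(t)+Bu(t)$, $y(t)=Hx(t)$, with $x(t)\in\mathbb{R}^n$, $u(t)\in\mathbb{R}^r$, $y(t)\in\mathbb{R}^p$. Let $\mathcal{H}_*$ be the span of the rows of $H$ in the dual space $\mathbb{R}^n_*$ of row vectors. Then there exists a bridge matrix $\Psi\in\mathbb{R}^{n\times p}$ such that the corresponding OR-system represents the exact dynamics of the observers $y=Hx$ of the system if and only if $\mathcal{H}_*$ is $A$-invariant, i.e. $\mathcal{H}_*A\subset\mathcal{H}_*$.
   Context: A bridge matrix here is a matrix $\Psi\in\mathbb{R}^{n\times p}$; it defines the product $M\ast_\Psi y:=M\Psi y$ of a matrix $M$ with $n$ columns and a vector $y\in\mathbb{R}^p$ (a dimension-keeping semi-tensor product). The observer-based realization (OR-system) of $\dot x=Ax+Bu$, $y=Hx$ associated with $\Psi$ is obtained from $\dot y=HAx+HBu$ by replacing $HAx$ with $HA\ast_\Psi y$, namely $\dot y(t)=HA\Psi\, y(t)+HBu(t)$. The OR-system represents the exact dynamics of the observers (is exact) if for every initial state $x(0)\in\mathbb{R}^n$ and every continuous input $u$, the output $y(t)=Hx(t)$ of the original system satisfies $\dot y(t)=HA\Psi\,y(t)+HBu(t)$. A subspace (dual subspace) $\mathcal{H}_*$ of $\mathbb{R}^n_*$ (row vectors) is $A$-invariant if $hA\in\mathcal{H}_*$ for all $h\in\mathcal{H}_*$. 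*)

theory Defs
  imports "HOL-Analysis.Analysis"
begin

text \<open>The column dimension of \<open>M\<close> and the dimension of \<open>y\<close> may differ; the bridge
  matrix \<open>\<Psi>\<close> mediates between them.\<close>

definition bridge_prod ::
    "real ^ 'p ^ 'n \<Rightarrow> real ^ 'n ^ 'm \<Rightarrow> real ^ 'p \<Rightarrow> real ^ 'm" where
  "bridge_prod \<Psi> M y = (M ** \<Psi>) *v y"

text \<open>Time is \<open>t \<ge> 0\<close>; the derivative at \<open>t = 0\<close> is the right-hand one.\<close>

definition control_trajectory ::
    "real ^ 'n ^ 'n \<Rightarrow> real ^ 'r ^ 'n \<Rightarrow> (real \<Rightarrow> real ^ 'r) \<Rightarrow> (real \<Rightarrow> real ^ 'n) \<Rightarrow> bool" where
  "control_trajectory A B u x \<longleftrightarrow>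
     (\<forall>t\<ge>0. (x has_vector_derivative (A *v x t + B *v u t)) (at t within {0..}))"

definition or_trajectory ::
    "real ^ 'n ^ 'n \<Rightarrow> real ^ 'r ^ 'n \<Rightarrow> real ^ 'n ^ 'p \<Rightarrow> real ^ 'p ^ 'n \<Rightarrow>
     (real \<Rightarrow> real ^ 'r) \<Rightarrow> (real \<Rightarrow> real ^ 'p) \<Rightarrow> bool" where
  "or_trajectory A B H \<Psi> u y \<longleftrightarrow>
     (\<forall>t\<ge>0. (y has_vector_derivative
        (bridge_prod \<Psi> (H ** A) (y t) + (H ** B) *v u t)) (at t within {0..}))"

text \<open>For each initial state and continuous input the state equation has exactly one
  solution \<open>x\<close> on \<open>t \<ge> 0\<close>, so the quantifier over \<open>x\<close> refers to that solution.\<close>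

definition or_system_exact ::
    "real ^ 'n ^ 'n \<Rightarrow> real ^ 'r ^ 'n \<Rightarrow> real ^ 'n ^ 'p \<Rightarrow> real ^ 'p ^ 'n \<Rightarrow> bool" where
  "or_system_exact A B H \<Psi> \<longleftrightarrow>
     (\<forall>x0 u x. continuous_on {0..} u \<longrightarrow> x 0 = x0 \<longrightarrow> control_trajectory A B u x \<longrightarrow>
        or_trajectory A B H \<Psi> u (\<lambda>t. H *v x t))"

text \<open>Row vectors, i.e. elements of the dual space, are represented by \<open>real ^ 'n\<close>, with
  \<open>h v* A\<close> the row vector \<open>hA\<close>.\<close>

definition dual_invariant :: "real ^ 'n ^ 'n \<Rightarrow> (real ^ 'n) set \<Rightarrow> bool" where
  "dual_invariant A S \<longleftrightarrow> subspace S \<and> (\<forall>h\<in>S. h v* A \<in> S)"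

end

theory Submission
  imports Defs
begin

text \<open>
  Testing exactness on the free trajectories \<open>exp (tA) x\<^sub>0\<close> at \<open>t = 0\<close> shows that it amounts to
  \<open>HA\<Psi>H = HA\<close>. Such a \<open>\<Psi>\<close> exhibits the rows of \<open>HA\<close> as combinations of the rows of \<open>H\<close>;
  conversely, a generalized inverse \<open>\<Psi>\<close> of \<open>H\<close> (that is, \<open>H\<Psi>H = H\<close>) makes \<open>\<Psi>H\<close> act from the
  right as the identity on the row space, which contains the rows of \<open>HA\<close> by invariance.
\<close>

text \<open>Supplies the majorant that makes the exponential series of \<open>A\<close> applied to
  \<open>v\<close> converge.\<close>

lemma norm_funpow_matrix_vector_mult_le:
  fixes A :: "real ^ 'n ^ 'n" and v :: "real ^ 'n"
  shows "norm (((*v) A ^^ k) v) \<le> onorm ((*v) A) ^ k * norm v"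
proof (induction k)
  case (Suc k)
  have "norm (((*v) A ^^ Suc k) v) \<le> onorm ((*v) A) * norm (((*v) A ^^ k) v)"
    using onorm[OF matrix_vector_mul_bounded_linear[of A]] by simp
  also have "\<dots> \<le> onorm ((*v) A) * (onorm ((*v) A) ^ k * norm v)"
    using Suc onorm_pos_le[OF matrix_vector_mul_bounded_linear[of A]] by (rule mult_left_mono)
  finally show ?case by (simp add: mult.assoc)
qed simp

text \<open>The solution is \<open>exp (tA) v\<close>. It is assembled from one real power series
  per coordinate, so that termwise differentiation of scalar power series applies.\<close>

lemma linear_ode_solution_exists:
  fixes A :: "real ^ 'n ^ 'n" and v :: "real ^ 'n"
  shows "\<exists>x. x 0 = v \<and> (\<forall>t. (x has_vector_derivative (A *v x t)) (at t))"
proof -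
  define c where "c j k = (((*v) A ^^ k) v) $ j / fact k" for j k
  define x where "x t = (\<chi> j. \<Sum>k. c j k * t ^ k)" for t
  have summ: "summable (\<lambda>k. c j k * t ^ k)" for j and t :: real
  proof (rule summable_comparison_test'[where N = 0])
    show "summable (\<lambda>k. norm v * ((onorm ((*v) A) * \<bar>t\<bar>) ^ k / fact k))"
      using summable_exp[of "onorm ((*v) A) * \<bar>t\<bar>"]
      by (intro summable_mult) (simp add: field_simps)
    show "norm (c j k * t ^ k) \<le> norm v * ((onorm ((*v) A) * \<bar>t\<bar>) ^ k / fact k)" for k
    proof -
      have "\<bar>(((*v) A ^^ k) v) $ j\<bar> \<le> onorm ((*v) A) ^ k * norm v"
        using component_le_norm_cart norm_funpow_matrix_vector_mult_le by (rule order_trans)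
      then have "\<bar>(((*v) A ^^ k) v) $ j\<bar> * (\<bar>t\<bar> ^ k / fact k)
          \<le> (onorm ((*v) A) ^ k * norm v) * (\<bar>t\<bar> ^ k / fact k)"
        by (rule mult_right_mono) simp
      then show ?thesis
        by (simp add: c_def abs_mult power_abs power_mult_distrib mult_ac)
    qed
  qed
  \<comment> \<open>Differentiation shifts the index: the factor \<open>Suc k\<close> reduces
    \<open>fact (Suc k)\<close> to \<open>fact k\<close>, and the extra application of
    \<open>A\<close> becomes row \<open>j\<close> of \<open>A\<close> acting on the coefficient
    vector.\<close>
  have diffs_c: "diffs (c j) k = (\<Sum>i\<in>UNIV. A $ j $ i * c i k)" for j k
  proof -
    have "diffs (c j) k = (((*v) A ^^ Suc k) v) $ j / fact k"
      unfolding diffs_def c_def by (simp add: divide_simps del: of_nat_Suc)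
    also have "\<dots> = (\<Sum>i\<in>UNIV. A $ j $ i * c i k)"
      by (simp add: c_def matrix_vector_mult_def sum_divide_distrib)
    finally show ?thesis .
  qed
  have deriv: "(x has_vector_derivative (A *v x t)) (at t)" for t
  proof -
    have "((\<lambda>t. x t $ j) has_real_derivative ((A *v x t) $ j)) (at t)" for j
    proof -
      have "((\<lambda>t. \<Sum>k. c j k * t ^ k) has_real_derivative (\<Sum>k. diffs (c j) k * t ^ k)) (at t)"
        by (rule termdiffs_strong_converges_everywhere) (rule summ)
      moreover have "(\<Sum>k. diffs (c j) k * t ^ k) = (A *v x t) $ j"
      proof -
        have "(\<Sum>k. diffs (c j) k * t ^ k) = (\<Sum>k. \<Sum>i\<in>UNIV. A $ j $ i * (c i k * t ^ k))"
          by (simp add: diffs_c sum_distrib_right mult.assoc)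
        also have "\<dots> = (\<Sum>i\<in>UNIV. \<Sum>k. A $ j $ i * (c i k * t ^ k))"
          by (rule suminf_sum) (intro summable_mult summ)
        also have "\<dots> = (\<Sum>i\<in>UNIV. A $ j $ i * (\<Sum>k. c i k * t ^ k))"
          by (simp add: suminf_mult summ)
        finally show ?thesis by (simp add: x_def matrix_vector_mult_def)
      qed
      ultimately show ?thesis by (simp add: x_def)
    qed
    then have "((\<lambda>t. x t $ j) has_derivative (\<lambda>h. h * (A *v x t) $ j)) (at t)" for j
      by (simp add: has_field_derivative_def mult_commute_abs)
    then show ?thesis
      unfolding has_vector_derivative_def has_derivative_componentwise_within[of x]
      by (auto simp: Basis_vec_def inner_axis)
  qed
  have "(\<Sum>k. c j k * 0 ^ k) = v $ j" for j
    unfolding powser_zero by (simp add: c_def)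
  then have "x 0 = v"
    by (simp add: x_def vec_eq_iff)
  with deriv show ?thesis by (intro exI[of _ x] conjI allI)
qed

text \<open>Both derivatives of the output contain the same term \<open>HBu\<close>, so comparing
  them leaves \<open>HA\<Psi>Hx = HAx\<close>. Since \<open>x 0\<close> is arbitrary, this is an
  identity of matrices.\<close>

lemma or_system_exact_iff:
  fixes A :: "real ^ 'n ^ 'n" and B :: "real ^ 'r ^ 'n" and H :: "real ^ 'n ^ 'p"
  shows "or_system_exact A B H \<Psi> \<longleftrightarrow> H ** A ** \<Psi> ** H = H ** A"
proof
  assume exact: "or_system_exact A B H \<Psi>"
  have "(H ** A ** \<Psi> ** H) *v v = (H ** A) *v v" for v
  proof -
    obtain x where x0: "x 0 = v" and deriv: "\<forall>t. (x has_vector_derivative (A *v x t)) (at t)"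
      using linear_ode_solution_exists[of v A] by (elim exE conjE)
    have "control_trajectory A B (\<lambda>_. 0) x"
      using has_vector_derivative_at_within[OF deriv[rule_format]]
      by (simp add: control_trajectory_def)
    then have "or_trajectory A B H \<Psi> (\<lambda>_. 0) (\<lambda>t. H *v x t)"
      by (rule exact[unfolded or_system_exact_def, rule_format, OF continuous_on_const refl])
    then have "((\<lambda>t. H *v x t) has_vector_derivative ((H ** A ** \<Psi>) *v (H *v v)))
        (at 0 within {0..})"
      by (auto simp: or_trajectory_def bridge_prod_def x0 dest: spec[of _ 0])
    moreover have "((\<lambda>t. H *v x t) has_vector_derivative (H *v (A *v v))) (at 0 within {0..})"
      using bounded_linear.has_vector_derivative[OF matrix_vector_mul_bounded_linear
          has_vector_derivative_at_within[OF deriv[rule_format, of 0]]] by (simp add: x0)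
    \<comment> \<open>A one-sided derivative is still unique, because \<open>0\<close> is a limit
      point of \<open>{0..}\<close>.\<close>
    ultimately have "(H ** A ** \<Psi>) *v (H *v v) = H *v (A *v v)"
      by (rule vector_derivative_unique_within[rotated]) (simp add: at_within_Ici_at_right)
    then show ?thesis
      by (simp add: matrix_vector_mul_assoc matrix_mul_assoc)
  qed
  then show "H ** A ** \<Psi> ** H = H ** A"
    by (simp add: matrix_eq)
next
  assume eq: "H ** A ** \<Psi> ** H = H ** A"
  have "((\<lambda>t. H *v x t) has_vector_derivative
      (bridge_prod \<Psi> (H ** A) (H *v x t) + (H ** B) *v u t)) (at t within {0..})"
    if "(x has_vector_derivative (A *v x t + B *v u t)) (at t within {0..})" for x u t
    using bounded_linear.has_vector_derivative[OF matrix_vector_mul_bounded_linear[of H] that]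
    by (simp add: bridge_prod_def matrix_vector_mul_assoc eq matrix_vector_right_distrib)
  then show "or_system_exact A B H \<Psi>"
    by (simp add: or_system_exact_def control_trajectory_def or_trajectory_def)
qed

text \<open>A linear right inverse of \<open>H\<close> on its range exists without any rank
  condition; its matrix serves as \<open>\<Psi>\<close>.\<close>

lemma matrix_generalized_inverse_exists:
  fixes H :: "real ^ 'n ^ 'p"
  obtains \<Psi> :: "real ^ 'p ^ 'n" where "H ** \<Psi> ** H = H"
proof -
  obtain g where g: "linear g" "\<And>v. H *v g (H *v v) = H *v v"
    using linear_exists_right_inverse_on[OF matrix_vector_mul_linear[of H] subspace_UNIV] by auto
  then have "(H ** matrix g ** H) *v v = H *v v" for v
    by (simp add: matrix_works flip: matrix_vector_mul_assoc)
  then show thesis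
    using that matrix_eq by blast
qed

lemma row_matrix_mult: "row i (M ** N) = row i M v* N"
  by (simp add: row_def vector_matrix_mult_def matrix_matrix_mult_def vec_eq_iff mult.commute)

lemma vector_matrix_mult_in_span_rows:
  fixes M :: "real ^ 'n ^ 'm"
  shows "v v* M \<in> span (rows M)"
proof -
  have "v v* M = (\<Sum>i\<in>UNIV. v $ i *\<^sub>R row i M)"
    by (simp add: vec_eq_iff vector_matrix_mult_def row_def mult.commute)
  also have "\<dots> \<in> span (rows M)"
    by (intro span_sum span_scale span_base) (auto simp: rows_def)
  finally show ?thesis .
qed

text \<open>As \<open>h \<mapsto> hA\<close> is linear, invariance need only be tested on the
  generators, and the rows of \<open>HA\<close> are the images of the rows of
  \<open>H\<close>.\<close>

lemma dual_invariant_span_rows_iff: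
  fixes A :: "real ^ 'n ^ 'n" and H :: "real ^ 'n ^ 'p"
  shows "dual_invariant A (span (rows H)) \<longleftrightarrow> (\<forall>i. row i (H ** A) \<in> span (rows H))"
proof
  assume rows: "\<forall>i. row i (H ** A) \<in> span (rows H)"
  have "h v* A \<in> span (rows H)" if "h \<in> span (rows H)" for h
    using that
  proof (induction rule: span_induct)
    case base
    show ?case
      by (auto simp: subspace_def vector_matrix_left_distrib span_zero span_add
          span_scale scaleR_vector_matrix_assoc)
  next
    case (step h)
    then show ?case using rows by (auto simp: rows_def row_matrix_mult)
  qed
  then show "dual_invariant A (span (rows H))"
    by (simp add: dual_invariant_def)
next
  assume "dual_invariant A (span (rows H))"
  then show "\<forall>i. row i (H ** A) \<in> span (rows H)"
    by (auto simp: dual_invariant_def row_matrix_mult rows_def intro: span_base)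
qed

theorem propositionV10:
  fixes A :: "real ^ 'n ^ 'n" and B :: "real ^ 'r ^ 'n" and H :: "real ^ 'n ^ 'p"
  shows "(\<exists>\<Psi> :: real ^ 'p ^ 'n. or_system_exact A B H \<Psi>) \<longleftrightarrow>
         dual_invariant A (span (rows H))"
proof
  assume "\<exists>\<Psi> :: real ^ 'p ^ 'n. or_system_exact A B H \<Psi>"
  then obtain \<Psi> :: "real ^ 'p ^ 'n" where "H ** A ** \<Psi> ** H = H ** A"
    by (auto simp: or_system_exact_iff)
  \<comment> \<open>The rows of \<open>HA\<Psi>\<close> are the coefficients that express the rows
    of \<open>HA\<close> through those of \<open>H\<close>.\<close>
  then have "row i (H ** A) = row i (H ** A ** \<Psi>) v* H" for i
    using row_matrix_mult[of i "H ** A ** \<Psi>" H] by simp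
  then show "dual_invariant A (span (rows H))"
    by (simp add: dual_invariant_span_rows_iff vector_matrix_mult_in_span_rows)
next
  assume inv: "dual_invariant A (span (rows H))"
  obtain \<Psi> :: "real ^ 'p ^ 'n" where \<Psi>: "H ** \<Psi> ** H = H"
    by (rule matrix_generalized_inverse_exists)
  \<comment> \<open>The row vectors fixed by \<open>\<Psi>H\<close> form a subspace, and
    \<open>H\<Psi>H = H\<close> says row by row that it contains the rows of
    \<open>H\<close>.\<close>
  have fix_rows: "h v* (\<Psi> ** H) = h" if "h \<in> span (rows H)" for h
    using that
  proof (induction rule: span_induct)
    case base
    show ?case
      by (auto simp: subspace_def vector_matrix_left_distrib scaleR_vector_matrix_assoc)
  next
    case (step h)
    then obtain i where "h = row i H"
      by (auto simp: rows_def)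
    then show ?case
      using row_matrix_mult[of i H "\<Psi> ** H"] \<Psi> by (simp add: matrix_mul_assoc)
  qed
  have "row i (H ** A ** \<Psi> ** H) = row i (H ** A)" for i
    using row_matrix_mult[of i "H ** A" "\<Psi> ** H"] fix_rows[of "row i (H ** A)"] inv
    by (simp add: matrix_mul_assoc dual_invariant_span_rows_iff)
  then have "H ** A ** \<Psi> ** H = H ** A"
    by (simp add: vec_eq_iff row_def)
  then show "\<exists>\<Psi> :: real ^ 'p ^ 'n. or_system_exact A B H \<Psi>"
    using or_system_exact_iff by blast
qed

end
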